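(* Let $\mathbb{F}$ be a field, $G$ a finite simple graph and $R\subseteq V(G)$. The algebra $\mathcal{H}(G,R)$ has dimension $|\mathcal{I}(G)|$ and two bases $\{X_I:I\in\mathcal{I}(G)\}$ and \[ \left\{X_{I+J}X^-_{G-R-I}: I\in\mathcal{I}(G-R),\ J\in\mathcal{I}(R-N(I))\right\}. \]
   Context: For a finite simple graph $G$ with vertex set $V(G)$ and edge set $E(G)$, and $R\subseteq V(G)$, $\mathcal{H}(G,R)$ is the quotient of the polynomial algebra $\mathbb{F}[x_v:v\in V(G)]$ by the ideal generated by $\{x_r^2:r\in R\}\cup\{x_v^2-x_v:v\in V(G)\setminus R\}\cup\{x_ux_v:uv\in E(G)\}$. The image of $x_v$ is still denoted $x_v$, and $x_v^-:=1-x_v$. For $U\subseteq V(G)$, $X_U:=\prod_{u\in U}x_u$ and $X_U^-:=\prod_{u\in U}x_u^-$; $N(U)$ is the set of all vertices adjacent in $G$ to some $u\in U$. The symbols $+$ and $-$ denote union and difference of sets, and a subset $U\subseteq V(G)$ is identified with the subgraph of $G$ it induces; thus $G-R$ is the subgraph induced by $V(G)\setminus R$, and $G-R-I$ stands for $V(G)\setminus(R\cup I)$. $\mathcal{I}(\cdot)$ denotes the set of all independent sets (sets of pairwise non-adjacent vertices, including $\emptyset$) of a graph. *)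

theory Defs
  imports
    "Graph_Theory.Digraph_Component"
    "Jordan_Normal_Form.VS_Connect"
    "HOL-Library.Poly_Mapping"
    "HOL-Algebra.QuotRing"
begin

text \<open>
  A finite simple graph is a \<^locale>\<open>graph\<close> of the Graph Theory entry: a finite, loop-free,
  symmetric digraph without parallel arcs. The empty graph is allowed.
\<close>

definition indep_sets :: "('v, 'e) pre_digraph \<Rightarrow> 'v set set" where
  "indep_sets G = {U. U \<subseteq> verts G \<and> (\<forall>u\<in>U. \<forall>v\<in>U. \<not> u \<rightarrow>\<^bsub>G\<^esub> v)}"

definition nbhd :: "('v, 'e) pre_digraph \<Rightarrow> 'v set \<Rightarrow> 'v set" where
  "nbhd G U = {v \<in> verts G. \<exists>u\<in>U. u \<rightarrow>\<^bsub>G\<^esub> v}"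

text \<open>
  A monomial is a finitely supported exponent function, a polynomial a finitely supported
  coefficient function on monomials; multiplication on that type is convolution. The algebra
  over a variable set \<open>V\<close> consists of the polynomials whose monomials involve only variables in
  \<open>V\<close>; the type of variables itself may be larger (or infinite).
\<close>

type_synonym ('v, 'k) mvpoly = "('v \<Rightarrow>\<^sub>0 nat) \<Rightarrow>\<^sub>0 'k"

definition pvar :: "'v \<Rightarrow> ('v, 'k::field) mvpoly" where
  "pvar v = Poly_Mapping.single (Poly_Mapping.single v 1) 1"

definition pconst :: "'k::field \<Rightarrow> ('v, 'k) mvpoly" where
  "pconst c = Poly_Mapping.single 0 c"

definition poly_algebra :: "'v set \<Rightarrow> ('k::field, ('v, 'k) mvpoly) module" where
  "poly_algebra V =
    \<lparr>carrier = {p. \<forall>m \<in> Poly_Mapping.keys p. Poly_Mapping.keys m \<subseteq> V},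
     mult = (*), one = 1, zero = 0, add = (+),
     smult = (\<lambda>c p. pconst c * p)\<rparr>"

definition graph_relations ::
    "('v, 'e) pre_digraph \<Rightarrow> 'v set \<Rightarrow> ('v, 'k::field) mvpoly set" where
  "graph_relations G R =
     {pvar r ^ 2 | r. r \<in> R}
     \<union> {pvar v ^ 2 - pvar v | v. v \<in> verts G - R}
     \<union> {pvar u * pvar v | u v. u \<rightarrow>\<^bsub>G\<^esub> v}"

definition graph_ideal ::
    "('v, 'e) pre_digraph \<Rightarrow> 'v set \<Rightarrow> ('v, 'k::field) mvpoly set" where
  "graph_ideal G R = Idl\<^bsub>poly_algebra (verts G)\<^esub> (graph_relations G R)"

abbreviation graph_coset ::
    "('v, 'e) pre_digraph \<Rightarrow> 'v set \<Rightarrow> ('v, 'k::field) mvpoly \<Rightarrow> ('v, 'k) mvpoly set" where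
  "graph_coset G R p \<equiv> graph_ideal G R +>\<^bsub>poly_algebra (verts G)\<^esub> p"

text \<open>
  The quotient ring, made into an algebra over the field by letting a scalar act as
  multiplication by the class of the corresponding constant polynomial.
\<close>

definition graph_algebra ::
    "('v, 'e) pre_digraph \<Rightarrow> 'v set \<Rightarrow> ('k::field, ('v, 'k) mvpoly set) module" where
  "graph_algebra G R =
    (let Q = poly_algebra (verts G) Quot graph_ideal G R in
      \<lparr>carrier = carrier Q, mult = mult Q, one = one Q, zero = zero Q, add = add Q,
       smult = (\<lambda>c A. graph_coset G R (pconst c) \<otimes>\<^bsub>Q\<^esub> A)\<rparr>)"

definition gvar :: "('v, 'e) pre_digraph \<Rightarrow> 'v set \<Rightarrow> 'v \<Rightarrow> ('v, 'k::field) mvpoly set" where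
  "gvar G R v = graph_coset G R (pvar v)"

definition X_prod :: "('v, 'e) pre_digraph \<Rightarrow> 'v set \<Rightarrow> 'v set \<Rightarrow> ('v, 'k::field) mvpoly set" where
  "X_prod G R U = (\<Otimes>\<^bsub>graph_algebra G R\<^esub>u\<in>U. gvar G R u)"

definition X_minus_prod ::
    "('v, 'e) pre_digraph \<Rightarrow> 'v set \<Rightarrow> 'v set \<Rightarrow> ('v, 'k::field) mvpoly set" where
  "X_minus_prod G R U =
     (\<Otimes>\<^bsub>graph_algebra G R\<^esub>u\<in>U. \<one>\<^bsub>graph_algebra G R\<^esub> \<ominus>\<^bsub>graph_algebra G R\<^esub> gvar G R u)"

lemma poly_algebra_cring: "cring (poly_algebra V :: ('k::field, ('v, 'k) mvpoly) module)"
proof (rule cringI)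
  let ?P = "poly_algebra V :: ('k, ('v, 'k) mvpoly) module"
  have keys_add': "Poly_Mapping.keys (p + q) \<subseteq> Poly_Mapping.keys p \<union> Poly_Mapping.keys q"
    for p q :: "('v, 'k) mvpoly"
    by (rule Poly_Mapping.keys_add)
  show "abelian_group ?P"
  proof (rule abelian_groupI)
    fix p assume p: "p \<in> carrier ?P"
    then have "- p \<in> carrier ?P" "- p \<oplus>\<^bsub>?P\<^esub> p = \<zero>\<^bsub>?P\<^esub>"
      by (auto simp: poly_algebra_def)
    then show "\<exists>q\<in>carrier ?P. q \<oplus>\<^bsub>?P\<^esub> p = \<zero>\<^bsub>?P\<^esub>" by blast
  qed (use keys_add' in \<open>fastforce simp: poly_algebra_def algebra_simps\<close>)+
  show "Group.comm_monoid ?P"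
  proof (rule comm_monoidI)
    fix p q assume pq: "p \<in> carrier ?P" "q \<in> carrier ?P"
    have "Poly_Mapping.keys m \<subseteq> V" if m: "m \<in> Poly_Mapping.keys (p * q)" for m
    proof -
      obtain a b where ab: "m = a + b" "a \<in> Poly_Mapping.keys p" "b \<in> Poly_Mapping.keys q"
        using m keys_mult[of p q] by blast
      then show ?thesis
        using pq Poly_Mapping.keys_add[of a b] by (fastforce simp: poly_algebra_def)
    qed
    then show "p \<otimes>\<^bsub>?P\<^esub> q \<in> carrier ?P" by (auto simp: poly_algebra_def)
  qed (auto simp: poly_algebra_def algebra_simps)
qed (auto simp: poly_algebra_def algebra_simps)

lemma pvar_closed: "v \<in> V \<Longrightarrow> pvar v \<in> carrier (poly_algebra V)"
  by (auto simp: poly_algebra_def pvar_def)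

lemma pconst_closed: "pconst c \<in> carrier (poly_algebra V)"
  by (auto simp: poly_algebra_def pconst_def)

lemma graph_relations_closed:
  assumes "graph G" "R \<subseteq> verts G"
  shows "graph_relations G R \<subseteq> carrier (poly_algebra (verts G))"
proof -
  interpret graph G by fact
  let ?P = "poly_algebra (verts G) :: ('k::field, ('a, 'k) mvpoly) module"
  interpret P: cring ?P by (rule poly_algebra_cring)
  have m: "p * q \<in> carrier ?P" if "p \<in> carrier ?P" "q \<in> carrier ?P" for p q
    using P.m_closed[OF that] by (simp add: poly_algebra_def)
  have s: "p - q \<in> carrier ?P" if "p \<in> carrier ?P" "q \<in> carrier ?P" for p q
  proof -
    have "- q \<in> carrier ?P" using that by (simp add: poly_algebra_def)
    from P.a_closed[OF that(1) this] show ?thesis by (simp add: poly_algebra_def)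
  qed
  show ?thesis
    using assms(2) unfolding graph_relations_def power2_eq_square
    by (auto intro!: m s pvar_closed dest: adj_in_verts)
qed

lemma graph_ideal_ideal:
  assumes "graph G" "R \<subseteq> verts G"
  shows "ideal (graph_ideal G R) (poly_algebra (verts G))"
  unfolding graph_ideal_def
  by (rule ring.genideal_ideal[OF cring.axioms(1)[OF poly_algebra_cring]
        graph_relations_closed[OF assms]])

lemma field_class_ring: "field (class_ring :: 'k::field ring)"
  by (rule class_field)

lemma graph_algebra_algebra:
  fixes G :: "('v, 'e) pre_digraph"
  assumes "graph G" "R \<subseteq> verts G"
  shows "algebra class_ring (graph_algebra G R :: ('k::field, ('v, 'k) mvpoly set) module)"
proof -
  let ?P = "poly_algebra (verts G) :: ('k::field, ('v, 'k) mvpoly) module"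
  let ?J = "graph_ideal G R :: ('v, 'k) mvpoly set"
  let ?H = "graph_algebra G R :: ('k, ('v, 'k) mvpoly set) module"
  let ?Q = "?P Quot ?J"
  let ?h = "\<lambda>c. ?J +>\<^bsub>?P\<^esub> pconst c"
  interpret P: cring ?P by (rule poly_algebra_cring)
  interpret J: ideal ?J ?P by (rule graph_ideal_ideal[OF assms])
  interpret Q: cring ?Q by (rule J.quotient_is_cring[OF P.is_cring])
  interpret h: ring_hom_ring ?P ?Q "(+>\<^bsub>?P\<^esub>) ?J" by (rule J.rcos_ring_hom_ring)
  have H: "carrier ?H = carrier ?Q" "mult ?H = mult ?Q" "one ?H = one ?Q" "zero ?H = zero ?Q"
    "add ?H = add ?Q" "smult ?H = (\<lambda>c A. ?h c \<otimes>\<^bsub>?Q\<^esub> A)"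
    by (simp_all add: graph_algebra_def Let_def)
  have c: "?h c \<in> carrier ?Q" for c by (rule h.hom_closed[OF pconst_closed])
  have ca: "?h (c + d) = ?h c \<oplus>\<^bsub>?Q\<^esub> ?h d" for c d
    using h.hom_add[OF pconst_closed pconst_closed, of c d]
    by (simp add: poly_algebra_def pconst_def single_add)
  have cm: "?h (c * d) = ?h c \<otimes>\<^bsub>?Q\<^esub> ?h d" for c d
    using h.hom_mult[OF pconst_closed pconst_closed, of c d]
    by (simp add: poly_algebra_def pconst_def mult_single)
  have c1: "?h 1 = \<one>\<^bsub>?Q\<^esub>"
    using h.hom_one by (simp add: poly_algebra_def pconst_def single_one)
  have mon: "Group.comm_monoid ?H"
  proof (rule comm_monoidI)
    fix x y assume "x \<in> carrier ?H" "y \<in> carrier ?H"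
    then show "x \<otimes>\<^bsub>?H\<^esub> y = y \<otimes>\<^bsub>?H\<^esub> x" unfolding H by (rule Q.m_comm)
  qed (simp_all add: H Q.m_assoc)
  have grp: "abelian_group ?H"
  proof (rule abelian_groupI)
    fix x y assume "x \<in> carrier ?H" "y \<in> carrier ?H"
    then show "x \<oplus>\<^bsub>?H\<^esub> y = y \<oplus>\<^bsub>?H\<^esub> x" unfolding H by (rule Q.a_comm)
  next
    fix x assume "x \<in> carrier ?H"
    then show "\<exists>y\<in>carrier ?H. y \<oplus>\<^bsub>?H\<^esub> x = \<zero>\<^bsub>?H\<^esub>" unfolding H by (rule Q.add.l_inv_ex[simplified])
  qed (simp_all add: H Q.a_assoc)
  have Hc: "cring ?H"
    by (rule cringI[OF grp mon]) (simp add: H Q.l_distr)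
  show ?thesis
  proof (rule algebraI)
    show "cring (class_ring :: 'k ring)" by (rule domain.axioms(1)[OF field.axioms(1)[OF field_class_ring]])
  qed (use Hc in \<open>simp_all add: H c ca cm c1 Q.l_distr Q.r_distr Q.m_assoc\<close>)
qed

lemma graph_algebra_vectorspace:
  fixes G :: "('v, 'e) pre_digraph"
  assumes "graph G" "R \<subseteq> verts G"
  shows "vectorspace class_ring (graph_algebra G R :: ('k::field, ('v, 'k) mvpoly set) module)"
  unfolding vectorspace_def
  using algebra.axioms(1)[OF graph_algebra_algebra[OF assms]] field_class_ring by blast

end

theory Submission
  imports Defs
begin

text \<open>
  Modulo the relations every monomial is \<open>0\<close> or some \<open>X_I\<close> with \<open>I\<close> independent. Conversely, for an
  independent set \<open>K\<close>, summing the coefficients of all monomials with support \<open>K\<close> that are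
  squarefree in the variables of \<open>R\<close> is a linear functional that vanishes on the ideal, and these
  functionals are dual to the \<open>X_I\<close>. For the second family, \<open>1 = x_v + x_v\<^sup>-\<close> lets one expand each
  \<open>X_I\<close> in it, so it is generating; it has at most as many members as there are independent
  sets, hence it is a basis.
\<close>

section \<open>Polynomials\<close>

lemma poly_mapping_sum_single:
  fixes p :: "'a \<Rightarrow>\<^sub>0 'b::comm_monoid_add"
  shows "(\<Sum>m\<in>Poly_Mapping.keys p. Poly_Mapping.single m (Poly_Mapping.lookup p m)) = p"
  by (rule poly_mapping_eqI)
    (auto simp: lookup_sum lookup_single when_def in_keys_iff)

text \<open>This lets \<open>update_induct\<close> be read multiplicatively: extending an exponent
  function at a fresh variable multiplies the monomial by a power of that variable.\<close>

lemma update_conv_add: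
  fixes f :: "'a \<Rightarrow>\<^sub>0 'b::comm_monoid_add"
  assumes "a \<notin> Poly_Mapping.keys f"
  shows "Poly_Mapping.update a b f = f + Poly_Mapping.single a b"
  using assms
  by (intro poly_mapping_eqI) (auto simp: lookup_update lookup_add lookup_single in_keys_iff when_def)

lemma prod_pvar:
  assumes "finite U"
  shows "(\<Prod>u\<in>U. pvar u) =
    (Poly_Mapping.single (\<Sum>u\<in>U. Poly_Mapping.single u 1) 1 :: ('v, 'k::field) mvpoly)"
  using assms by induction (simp_all add: pvar_def mult_single single_one)

lemma lookup_sum_single_one:
  assumes "finite U"
  shows "Poly_Mapping.lookup (\<Sum>u\<in>U. Poly_Mapping.single u (1::nat)) v = (if v \<in> U then 1 else 0)"
  using assms by (simp add: lookup_sum lookup_single when_def)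

text \<open>Natural exponents cannot cancel, so the general inclusion for sums becomes an
  equality.\<close>

lemma keys_add_nat:
  fixes m n :: "'v \<Rightarrow>\<^sub>0 nat"
  shows "Poly_Mapping.keys (m + n) = Poly_Mapping.keys m \<union> Poly_Mapping.keys n"
  by (auto simp: in_keys_iff lookup_add)

text \<open>
  The monomials that the relations identify with \<open>X_K\<close> when \<open>K\<close> is independent.
\<close>

definition reduces_to :: "'v set \<Rightarrow> 'v set \<Rightarrow> ('v \<Rightarrow>\<^sub>0 nat) \<Rightarrow> bool" where
  "reduces_to R K m \<longleftrightarrow> Poly_Mapping.keys m = K \<and> (\<forall>r\<in>R. Poly_Mapping.lookup m r \<le> 1)"

section \<open>Linear functionals that vanish on all multiples of the relations\<close>

definition reduced_coeff :: "'v set \<Rightarrow> 'v set \<Rightarrow> ('v, 'k::field) mvpoly \<Rightarrow> 'k" where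
  "reduced_coeff R K p =
    (\<Sum>m\<in>Poly_Mapping.keys p. if reduces_to R K m then Poly_Mapping.lookup p m else 0)"

text \<open>The index set \<open>keys p\<close> varies with \<open>p\<close>; comparing the values
  at two polynomials requires a common finite index set.\<close>

lemma reduced_coeff_superset:
  assumes "finite A" "Poly_Mapping.keys p \<subseteq> A"
  shows "reduced_coeff R K p = (\<Sum>m\<in>A. if reduces_to R K m then Poly_Mapping.lookup p m else 0)"
  unfolding reduced_coeff_def using assms
  by (intro sum.mono_neutral_left) (auto simp: in_keys_iff)

lemma reduced_coeff_0 [simp]: "reduced_coeff R K 0 = 0"
  by (simp add: reduced_coeff_def)

lemma reduced_coeff_single:
  "reduced_coeff R K (Poly_Mapping.single m c) = (if reduces_to R K m then c else 0)"
  using reduced_coeff_superset[of "{m}" "Poly_Mapping.single m c" R K] by simp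

lemma reduced_coeff_add:
  fixes p q :: "('v, 'k::field) mvpoly"
  shows "reduced_coeff R K (p + q) = reduced_coeff R K p + reduced_coeff R K q"
proof -
  let ?A = "Poly_Mapping.keys p \<union> Poly_Mapping.keys q"
  have "reduced_coeff R K s = (\<Sum>m\<in>?A. if reduces_to R K m then Poly_Mapping.lookup s m else 0)"
    if "Poly_Mapping.keys s \<subseteq> ?A" for s :: "('v, 'k) mvpoly"
    using that by (intro reduced_coeff_superset) auto
  note on_A = this
  show ?thesis
    unfolding on_A[of p, OF Un_upper1] on_A[of q, OF Un_upper2]
      on_A[of "p + q", OF Poly_Mapping.keys_add] sum.distrib[symmetric]
    by (rule sum.cong) (simp_all add: lookup_add)
qed

lemma reduced_coeff_sum: "reduced_coeff R K (sum f A) = (\<Sum>a\<in>A. reduced_coeff R K (f a))"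
  by (induction A rule: infinite_finite_induct) (simp_all add: reduced_coeff_add)

lemma reduced_coeff_diff: "reduced_coeff R K (p - q) = reduced_coeff R K p - reduced_coeff R K q"
  using reduced_coeff_add[of R K "p - q" q] by simp

text \<open>By linearity, vanishing on all multiples of \<open>g\<close> need only be checked on
  monomial multiples.\<close>

lemma reduced_coeff_mult_left:
  "reduced_coeff R K (p * g) =
    (\<Sum>m\<in>Poly_Mapping.keys p.
      reduced_coeff R K (Poly_Mapping.single m (Poly_Mapping.lookup p m) * g))"
  by (subst (1) poly_mapping_sum_single[of p, symmetric])
    (simp add: sum_distrib_right reduced_coeff_sum)

lemma reduced_coeff_pconst_mult: "reduced_coeff R K (pconst c * p) = c * reduced_coeff R K p"
proof -
  have "reduced_coeff R K (p * pconst c) =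
      (\<Sum>m\<in>Poly_Mapping.keys p. c * (if reduces_to R K m then Poly_Mapping.lookup p m else 0))"
    unfolding reduced_coeff_mult_left[of R K p]
    by (intro sum.cong) (auto simp: pconst_def mult_single reduced_coeff_single)
  then show ?thesis
    by (simp add: reduced_coeff_def sum_distrib_left mult.commute)
qed

text \<open>After multiplication by a monomial, a square of a variable in \<open>R\<close> has an
  exponent of at least 2 there and is not counted. For \<open>v\<close> outside \<open>R\<close>,
  the two terms have the same support and the same exponents on \<open>R\<close>, so they are
  counted alike and cancel. The product of two adjacent variables has an edge in its support, which
  therefore is not the independent set \<open>K\<close>.\<close>

lemma reduced_coeff_relation:
  assumes g: "g \<in> graph_relations G R" and K: "K \<in> indep_sets G"
  shows "reduced_coeff R K (q * g) = 0"
proof -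
  have "reduced_coeff R K (Poly_Mapping.single m c * g) = 0" for m c
    using g unfolding graph_relations_def
  proof (elim UnE CollectE exE conjE)
    fix r assume "g = pvar r ^ 2" "r \<in> R"
    then show ?thesis
      by (auto simp: power2_eq_square pvar_def mult_single reduced_coeff_single reduces_to_def
          lookup_add intro!: bexI[of _ r])
  next
    fix v assume g: "g = pvar v ^ 2 - pvar v" and v: "v \<in> verts G - R"
    have "reduces_to R K (m + (Poly_Mapping.single v 1 + Poly_Mapping.single v 1)) =
        reduces_to R K (m + Poly_Mapping.single v 1)"
      using v by (auto simp: reduces_to_def keys_add_nat lookup_add lookup_single when_def)
    then show ?thesis
      by (simp add: g power2_eq_square pvar_def right_diff_distrib mult_single
          reduced_coeff_diff reduced_coeff_single)
  next
    fix u v assume g: "g = pvar u * pvar v" and uv: "u \<rightarrow>\<^bsub>G\<^esub> v"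
    have "\<not> reduces_to R K (m + (Poly_Mapping.single u 1 + Poly_Mapping.single v 1))"
      using K uv by (auto simp: reduces_to_def keys_add_nat indep_sets_def)
    then show ?thesis
      by (simp add: g pvar_def mult_single reduced_coeff_single)
  qed
  then show ?thesis
    by (subst reduced_coeff_mult_left) simp
qed

lemma poly_algebra_minus:
  assumes "p \<in> carrier (poly_algebra V)" "q \<in> carrier (poly_algebra V)"
  shows "p \<ominus>\<^bsub>poly_algebra V\<^esub> q = p - q"
proof -
  interpret P: cring "poly_algebra V" by (rule poly_algebra_cring)
  have "- q \<in> carrier (poly_algebra V)"
    using assms(2) by (simp add: poly_algebra_def)
  then have "\<ominus>\<^bsub>poly_algebra V\<^esub> q = - q"
    using assms(2) by (intro P.minus_equality) (auto simp: poly_algebra_def)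
  then show ?thesis
    by (simp add: P.minus_eq) (simp add: poly_algebra_def)
qed

section \<open>The quotient algebra\<close>

text \<open>The parameter \<open>F\<close> pins down the coefficient field \<open>'k\<close>, which
  the types of \<open>G\<close> and \<open>R\<close> do not mention.\<close>

locale graph_quotient = graph G for G :: "('v, 'e) pre_digraph" +
  fixes R :: "'v set" and F :: "'k::field itself"
  assumes R_subset: "R \<subseteq> verts G"
begin

abbreviation P :: "('k, ('v, 'k) mvpoly) module" where "P \<equiv> poly_algebra (verts G)"
abbreviation J :: "('v, 'k) mvpoly set" where "J \<equiv> graph_ideal G R"
abbreviation H :: "('k, ('v, 'k) mvpoly set) module" where "H \<equiv> graph_algebra G R"
abbreviation cls :: "('v, 'k) mvpoly \<Rightarrow> ('v, 'k) mvpoly set" where "cls \<equiv> graph_coset G R"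
abbreviation x :: "'v \<Rightarrow> ('v, 'k) mvpoly set" where "x \<equiv> gvar G R"
abbreviation X :: "'v set \<Rightarrow> ('v, 'k) mvpoly set" where "X \<equiv> X_prod G R"
abbreviation Xm :: "'v set \<Rightarrow> ('v, 'k) mvpoly set" where "Xm \<equiv> X_minus_prod G R"

lemma is_graph: "graph G" by (rule graph_axioms)

lemma P_simps: "mult P = (*)" "one P = 1" "zero P = 0" "add P = (+)"
  by (simp_all add: poly_algebra_def)

lemma H_simps: "carrier H = carrier (P Quot J)" "mult H = mult (P Quot J)"
    "one H = one (P Quot J)" "zero H = zero (P Quot J)" "add H = add (P Quot J)"
    "smult H = (\<lambda>c A. cls (pconst c) \<otimes>\<^bsub>P Quot J\<^esub> A)"
  by (simp_all add: graph_algebra_def Let_def)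

sublocale P: cring P by (rule poly_algebra_cring)

sublocale J: ideal J P by (rule graph_ideal_ideal[OF is_graph R_subset])

sublocale H: vectorspace "class_ring :: 'k ring" H
  by (rule graph_algebra_vectorspace[OF is_graph R_subset])

lemma H_cring: "cring H"
  using graph_algebra_algebra[OF is_graph R_subset] by (rule algebra.axioms(2))

sublocale HR: cring H by (rule H_cring)

lemma cls_hom: "cls \<in> Ring.ring_hom P H"
  using J.rcos_ring_hom unfolding Ring.ring_hom_def H_simps .

sublocale cls: ring_hom_cring P H cls
  by unfold_locales (rule cls_hom)

lemma cls_surj:
  assumes "A \<in> carrier H"
  obtains p where "p \<in> carrier P" "A = cls p"
proof -
  have "\<exists>p\<in>carrier P. A = cls p"
    using assms unfolding H_simps FactRing_def partial_object.simps A_RCOSETS_def' by blast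
  then show thesis
    by (elim bexE) (rule that)
qed

lemma cls_eq_iff: "p \<in> carrier P \<Longrightarrow> q \<in> carrier P \<Longrightarrow> cls p = cls q \<longleftrightarrow> p - q \<in> J"
  using P.quotient_eq_iff_same_a_r_cos[OF J.ideal_axioms, of p q] poly_algebra_minus[of p "verts G" q]
  by simp

lemma cls_smult: "p \<in> carrier P \<Longrightarrow> c \<odot>\<^bsub>H\<^esub> cls p = cls (pconst c * p)"
  using cls.hom_mult[OF pconst_closed, of p c] by (simp add: H_simps P_simps)

lemma cls_add: "p \<in> carrier P \<Longrightarrow> q \<in> carrier P \<Longrightarrow> cls (p + q) = cls p \<oplus>\<^bsub>H\<^esub> cls q"
  using cls.hom_add[of p q] by (simp add: P_simps)

lemma cls_mult: "p \<in> carrier P \<Longrightarrow> q \<in> carrier P \<Longrightarrow> cls (p * q) = cls p \<otimes>\<^bsub>H\<^esub> cls q"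
  using cls.hom_mult[of p q] by (simp add: P_simps)

lemma cls_0: "cls 0 = \<zero>\<^bsub>H\<^esub>"
  using cls.hom_zero by (simp add: P_simps)

lemma cls_1: "cls 1 = \<one>\<^bsub>H\<^esub>"
  using cls.hom_one by (simp add: P_simps)

lemma relation_in_J: "g \<in> graph_relations G R \<Longrightarrow> g \<in> J"
  using P.genideal_self[OF graph_relations_closed[OF is_graph R_subset]]
  by (auto simp: graph_ideal_def)

lemma cls_eq_0: "g \<in> J \<Longrightarrow> cls g = \<zero>\<^bsub>H\<^esub>"
  using cls_eq_iff[of g 0] J.a_subset P.zero_closed by (auto simp: cls_0 P_simps)

lemma x_closed: "v \<in> verts G \<Longrightarrow> x v \<in> carrier H"
  unfolding gvar_def by (intro cls.hom_closed pvar_closed)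

lemma x_mult: "u \<in> verts G \<Longrightarrow> v \<in> verts G \<Longrightarrow> x u \<otimes>\<^bsub>H\<^esub> x v = cls (pvar u * pvar v)"
  by (simp add: gvar_def cls_mult pvar_closed)

lemma x_mult_self_R:
  assumes "r \<in> R"
  shows "x r \<otimes>\<^bsub>H\<^esub> x r = \<zero>\<^bsub>H\<^esub>"
proof -
  have "pvar r * pvar r \<in> J"
    using assms by (intro relation_in_J) (auto simp: graph_relations_def power2_eq_square)
  then show ?thesis
    using assms R_subset by (simp add: x_mult subset_iff cls_eq_0)
qed

lemma x_mult_self:
  assumes "v \<in> verts G - R"
  shows "x v \<otimes>\<^bsub>H\<^esub> x v = x v"
proof -
  have "pvar v * pvar v \<in> carrier P"
    using assms P.m_closed[OF pvar_closed pvar_closed, of v v] by (simp add: P_simps)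
  moreover have "pvar v ^ 2 - pvar v \<in> J"
    using assms by (intro relation_in_J) (auto simp: graph_relations_def)
  ultimately have "cls (pvar v * pvar v) = cls (pvar v)"
    using assms by (subst cls_eq_iff) (auto simp: pvar_closed power2_eq_square)
  then show ?thesis
    using assms by (simp add: x_mult gvar_def[symmetric])
qed

lemma x_mult_adj:
  assumes "u \<rightarrow>\<^bsub>G\<^esub> v"
  shows "x u \<otimes>\<^bsub>H\<^esub> x v = \<zero>\<^bsub>H\<^esub>"
proof -
  have "pvar u * pvar v \<in> J"
    using assms by (intro relation_in_J) (auto simp: graph_relations_def)
  then show ?thesis
    using adj_in_verts[OF assms] by (simp add: x_mult cls_eq_0)
qed

section \<open>Products of generators\<close>

lemma finite_subset_verts: "U \<subseteq> verts G \<Longrightarrow> finite U"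
  by (rule finite_subset[OF _ finite_verts])

lemma X_closed: "U \<subseteq> verts G \<Longrightarrow> X U \<in> carrier H"
  unfolding X_prod_def by (intro HR.finprod_closed) (auto intro: x_closed)

lemma Xm_closed: "U \<subseteq> verts G \<Longrightarrow> Xm U \<in> carrier H"
  unfolding X_minus_prod_def by (intro HR.finprod_closed) (auto intro: x_closed)

lemma X_empty: "X {} = \<one>\<^bsub>H\<^esub>" and Xm_empty: "Xm {} = \<one>\<^bsub>H\<^esub>"
  by (simp_all add: X_prod_def X_minus_prod_def)

lemma X_insert:
  assumes "insert v U \<subseteq> verts G" "v \<notin> U"
  shows "X (insert v U) = x v \<otimes>\<^bsub>H\<^esub> X U"
  unfolding X_prod_def using assms finite_subset_verts[of U]
  by (intro HR.finprod_insert) (auto intro: x_closed)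

lemma Xm_insert:
  assumes "insert v U \<subseteq> verts G" "v \<notin> U"
  shows "Xm (insert v U) = (\<one>\<^bsub>H\<^esub> \<ominus>\<^bsub>H\<^esub> x v) \<otimes>\<^bsub>H\<^esub> Xm U"
  unfolding X_minus_prod_def using assms finite_subset_verts[of U]
  by (intro HR.finprod_insert) (auto intro: x_closed)

text \<open>This supplies a polynomial representative of \<open>X U\<close> on which
  \<open>reduced_coeff\<close> can be evaluated.\<close>

lemma X_conv_cls:
  assumes "U \<subseteq> verts G"
  shows "X U = cls (\<Prod>u\<in>U. pvar u)" and "(\<Prod>u\<in>U. pvar u) \<in> carrier P"
proof -
  have "X U = cls (\<Prod>u\<in>U. pvar u) \<and> (\<Prod>u\<in>U. pvar u) \<in> carrier P"
    using finite_subset_verts[OF assms] assms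
  proof (induction U)
    case empty
    then show ?case using P.one_closed by (simp add: X_empty cls_1 P_simps)
  next
    case (insert v U)
    with P.m_closed[OF pvar_closed, of v "\<Prod>u\<in>U. pvar u"] show ?case
      by (simp add: X_insert cls_mult pvar_closed gvar_def P_simps)
  qed
  then show "X U = cls (\<Prod>u\<in>U. pvar u)" "(\<Prod>u\<in>U. pvar u) \<in> carrier P" by auto
qed

text \<open>Such a \<open>U\<close> contains two adjacent vertices, distinct because there are no
  loops; their two factors can be split off and already multiply to zero.\<close>

lemma X_eq_0:
  assumes "U \<subseteq> verts G" "U \<notin> indep_sets G"
  shows "X U = \<zero>\<^bsub>H\<^esub>"
proof -
  obtain u v where uv: "u \<in> U" "v \<in> U" "u \<rightarrow>\<^bsub>G\<^esub> v"
    using assms by (auto simp: indep_sets_def)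
  then have "u \<noteq> v" using adj_not_same by blast
  define W where "W = U - {u, v}"
  have U: "U = insert u (insert v W)"
    using uv by (auto simp: W_def)
  have "X U = x u \<otimes>\<^bsub>H\<^esub> (x v \<otimes>\<^bsub>H\<^esub> X W)"
    using assms(1) uv \<open>u \<noteq> v\<close>
    by (subst U) (simp add: X_insert W_def subset_iff)
  also have "\<dots> = (x u \<otimes>\<^bsub>H\<^esub> x v) \<otimes>\<^bsub>H\<^esub> X W"
    using assms(1) uv by (intro HR.m_assoc[symmetric] x_closed X_closed) (auto simp: W_def)
  also have "\<dots> = \<zero>\<^bsub>H\<^esub>"
    using x_mult_adj[OF uv(3)] X_closed[of W] assms(1) by (simp add: W_def subset_iff)
  finally show ?thesis .
qed

text \<open>A factor that occurs already gives a square, which is zero for \<open>v\<close> in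
  \<open>R\<close> and idempotent otherwise. Hence zero and the squarefree products are closed under
  multiplication by a generator, which drives the reduction of monomials.\<close>

lemma x_mult_X:
  assumes "v \<in> verts G" "U \<subseteq> verts G"
  shows "x v \<otimes>\<^bsub>H\<^esub> X U \<in> insert \<zero>\<^bsub>H\<^esub> (X ` Pow (verts G))"
proof (cases "v \<in> U")
  case False
  then have "x v \<otimes>\<^bsub>H\<^esub> X U = X (insert v U)"
    using assms by (intro X_insert[symmetric]) auto
  with assms show ?thesis by auto
next
  case True
  define W where "W = U - {v}"
  have U: "U = insert v W" "v \<notin> W"
    using True by (auto simp: W_def)
  have XU: "X U = x v \<otimes>\<^bsub>H\<^esub> X W"
    using U assms by (simp add: X_insert)
  then have "x v \<otimes>\<^bsub>H\<^esub> X U = (x v \<otimes>\<^bsub>H\<^esub> x v) \<otimes>\<^bsub>H\<^esub> X W"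
    using assms U by (simp add: HR.m_assoc x_closed X_closed)
  also have "\<dots> = (if v \<in> R then \<zero>\<^bsub>H\<^esub> else X U)"
    using assms U XU x_mult_self_R[of v] x_mult_self[of v] X_closed[of W] by simp
  finally show ?thesis using assms by auto
qed

section \<open>Reduction of monomials to squarefree products\<close>

lemma single_closed: "Poly_Mapping.keys m \<subseteq> verts G \<Longrightarrow> Poly_Mapping.single m c \<in> carrier P"
  by (auto simp: poly_algebra_def)

lemma cls_monomial:
  assumes "Poly_Mapping.keys m \<subseteq> verts G"
  shows "cls (Poly_Mapping.single m 1) \<in> insert \<zero>\<^bsub>H\<^esub> (X ` Pow (verts G))"
  using assms
proof (induction m rule: update_induct)
  case const
  then show ?case by (auto simp: single_one cls_1 X_empty[symmetric])
next
  case (update m v n)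
  then have keys: "Poly_Mapping.keys m \<subseteq> verts G" and v: "v \<in> verts G"
    by (auto simp: update_conv_add keys_add_nat)
  \<comment> \<open>The outer induction adds a variable \<open>v\<close>; the inner one raises its
    exponent from 0, one factor \<open>x v\<close> at a time.\<close>
  have "cls (Poly_Mapping.single (m + Poly_Mapping.single v n) 1) \<in>
      insert \<zero>\<^bsub>H\<^esub> (X ` Pow (verts G))" for n
  proof (induction n)
    case 0
    then show ?case using update.IH[OF keys] by simp
  next
    case (Suc n)
    let ?m = "m + Poly_Mapping.single v n"
    have "Poly_Mapping.single (m + Poly_Mapping.single v (Suc n)) 1 =
        pvar v * (Poly_Mapping.single ?m 1 :: ('v, 'k) mvpoly)"
      using single_add[of v 1 n] by (simp add: pvar_def mult_single add_ac)
    moreover have "Poly_Mapping.keys ?m \<subseteq> verts G"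
      using keys v by (auto simp: keys_add_nat split: if_splits)
    ultimately have "cls (Poly_Mapping.single (m + Poly_Mapping.single v (Suc n)) 1) =
        x v \<otimes>\<^bsub>H\<^esub> cls (Poly_Mapping.single ?m 1)"
      using v by (simp add: cls_mult pvar_closed single_closed gvar_def)
    then show ?case
      using Suc x_mult_X[OF v] HR.r_null[OF x_closed[OF v]] by (elim insertE imageE) simp_all
  qed
  then show ?case using update by (simp add: update_conv_add)
qed

section \<open>The first basis\<close>

text \<open>The class of a monomial is zero or a squarefree product, and such a product vanishes
  unless its index set is independent; so \<open>S\<close> contains the classes of all monomials,
  hence of all polynomials. An arbitrary submodule is allowed so that the spans of both families are
  covered.\<close>

lemma submodule_eq_carrier:
  assumes S: "submodule class_ring S H" and X: "\<And>I. I \<in> indep_sets G \<Longrightarrow> X I \<in> S"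
  shows "S = carrier H"
proof -
  interpret S: submodule class_ring S H by fact
  have mon: "cls (Poly_Mapping.single m 1) \<in> S" if "Poly_Mapping.keys m \<subseteq> verts G" for m
    using cls_monomial[OF that] X X_eq_0 S.zero_closed by (metis PowD imageE insertE)
  have "cls p \<in> S" if p: "p \<in> carrier P" for p
  proof -
    let ?f = "\<lambda>m. Poly_Mapping.single m (Poly_Mapping.lookup p m)"
    \<comment> \<open>Membership of the partial sums in \<open>carrier P\<close> is carried along
      because \<open>cls_add\<close> requires it.\<close>
    have "sum ?f A \<in> carrier P \<and> cls (sum ?f A) \<in> S"
      if "finite A" "A \<subseteq> Poly_Mapping.keys p" for A
      using that
    proof (induction A)
      case empty
      then show ?case using P.zero_closed S.zero_closed by (simp add: cls_0 P_simps)
    next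
      case (insert m A)
      have m: "Poly_Mapping.keys m \<subseteq> verts G"
        using insert.prems p by (auto simp: poly_algebra_def)
      have "?f m = pconst (Poly_Mapping.lookup p m) * Poly_Mapping.single m 1"
        by (simp add: pconst_def mult_single)
      then have "cls (?f m) \<in> S"
        using m cls_smult[OF single_closed[OF m], symmetric] mon[OF m] S.smult_closed by simp
      then show ?case
        using insert P.a_closed[OF single_closed[OF m], of "sum ?f A" "Poly_Mapping.lookup p m"]
          S.m_closed single_closed[OF m]
        by (simp add: cls_add P_simps)
    qed
    from this[of "Poly_Mapping.keys p"] show ?thesis by (simp add: poly_mapping_sum_single)
  qed
  then have "carrier H \<subseteq> S"
    by (metis cls_surj subsetI)
  with S.subset show ?thesis by blast
qed

section \<open>Coordinate functionals on the quotient and linear independence\<close>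

lemma reduced_coeff_ideal:
  assumes "K \<in> indep_sets G" "p \<in> J"
  shows "reduced_coeff R K p = 0"
proof -
  \<comment> \<open>The kernel of a linear functional need not be an ideal. Asking that all
    multiples of \<open>p\<close> lie in the kernel gives an ideal, which contains the relations and
    hence \<open>J\<close>; the multiplier 1 then yields the claim.\<close>
  define Z where "Z = {p \<in> carrier P. \<forall>q. reduced_coeff R K (q * p) = 0}"
  have "ideal Z P"
  proof (rule idealI)
    show "ring P" by (rule P.ring_axioms)
    show "subgroup Z (add_monoid P)"
    proof (rule P.add.subgroupI)
      show "Z \<subseteq> carrier P" by (auto simp: Z_def)
      show "Z \<noteq> {}" using P.zero_closed by (auto simp: Z_def P_simps)
      fix p assume p: "p \<in> Z"
      then have "\<ominus>\<^bsub>P\<^esub> p = - p"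
        using poly_algebra_minus[OF P.zero_closed, of p] by (simp add: Z_def P_simps P.minus_eq)
      moreover have "reduced_coeff R K (- q) = - reduced_coeff R K q" for q :: "('v, 'k) mvpoly"
        using reduced_coeff_diff[of R K 0 q] by simp
      ultimately show "\<ominus>\<^bsub>P\<^esub> p \<in> Z"
        using p P.a_inv_closed[of p] by (simp add: Z_def)
    next
      fix p q assume "p \<in> Z" "q \<in> Z"
      then show "p \<oplus>\<^bsub>P\<^esub> q \<in> Z"
        using P.a_closed[of p q] by (auto simp: Z_def P_simps distrib_left reduced_coeff_add)
    qed
  next
    fix p q assume "p \<in> Z" "q \<in> carrier P"
    then show "q \<otimes>\<^bsub>P\<^esub> p \<in> Z" "p \<otimes>\<^bsub>P\<^esub> q \<in> Z"
      using P.m_closed[of q p]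
      by (auto simp: Z_def P_simps mult.assoc[symmetric] mult.commute[of p q])
  qed
  moreover have "graph_relations G R \<subseteq> Z"
    using graph_relations_closed[OF is_graph R_subset] reduced_coeff_relation[OF _ assms(1)]
    by (auto simp: Z_def)
  ultimately have "J \<subseteq> Z"
    unfolding graph_ideal_def by (rule P.genideal_minimal)
  then have "reduced_coeff R K (1 * p) = 0"
    using assms(2) unfolding Z_def by blast
  then show ?thesis by simp
qed

text \<open>The functional is transported to cosets through a chosen representative. For independent
  \<open>L\<close> the choice is immaterial: representatives differ by an element of
  \<open>J\<close>, where \<open>reduced_coeff\<close> vanishes.\<close>

definition coord :: "'v set \<Rightarrow> ('v, 'k) mvpoly set \<Rightarrow> 'k" where
  "coord L A = reduced_coeff R L (SOME p. p \<in> A)"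

lemma coord_cls:
  assumes "L \<in> indep_sets G" "p \<in> carrier P"
  shows "coord L (cls p) = reduced_coeff R L p"
proof -
  have "p \<in> cls p" using assms(2) by (rule J.a_rcos_self)
  then have "(SOME q. q \<in> cls p) \<in> cls p" by (rule someI)
  then obtain j where "j \<in> J" "(SOME q. q \<in> cls p) = j + p"
    by (auto simp: a_r_coset_def' P_simps)
  then show ?thesis
    using assms(1) by (simp add: coord_def reduced_coeff_add reduced_coeff_ideal)
qed

text \<open>The representative of \<open>X I\<close> is a single monomial with support
  \<open>I\<close> and all exponents at most 1, so it is counted exactly when the supports agree.
  This duality gives both the linear independence and the injectivity of \<open>X\<close>.\<close>

lemma coord_X:
  assumes "L \<in> indep_sets G" "I \<in> indep_sets G"
  shows "coord L (X I) = (if L = I then 1 else 0)"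
proof -
  have I: "I \<subseteq> verts G" using assms(2) by (simp add: indep_sets_def)
  note fin = finite_subset_verts[OF I]
  have "Poly_Mapping.keys (\<Sum>u\<in>I. Poly_Mapping.single u (1::nat)) = I"
    by (auto simp: in_keys_iff lookup_sum_single_one[OF fin, simplified] split: if_splits)
  then have "reduces_to R L (\<Sum>u\<in>I. Poly_Mapping.single u 1) \<longleftrightarrow> L = I"
    by (auto simp: reduces_to_def lookup_sum_single_one[OF fin, simplified])
  then show ?thesis
    using X_conv_cls[OF I] assms(1)
    by (simp add: coord_cls prod_pvar[OF fin] reduced_coeff_single)
qed

lemma coord_lincomb:
  assumes L: "L \<in> indep_sets G" and "finite A" "A \<subseteq> carrier H"
  shows "coord L (H.lincomb a A) = (\<Sum>v\<in>A. a v * coord L v)"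
  using assms(2,3)
proof (induction A)
  case empty
  then show ?case
    using coord_cls[OF L P.zero_closed] by (simp add: H.lincomb_def cls_0 P_simps)
next
  case (insert v A)
  obtain p where p: "p \<in> carrier P" "v = cls p"
    using insert.prems cls_surj[of v] by blast
  have "H.lincomb a A \<in> carrier H"
    using insert.prems by (intro H.lincomb_closed) (auto simp: class_ring_simps)
  then obtain q where q: "q \<in> carrier P" "H.lincomb a A = cls q"
    by (rule cls_surj)
  have "H.lincomb a (insert v A) = a v \<odot>\<^bsub>H\<^esub> v \<oplus>\<^bsub>H\<^esub> H.lincomb a A"
    unfolding H.lincomb_def using insert
    by (intro H.M.finsum_insert) (auto intro!: H.smult_closed simp: class_ring_simps)
  also have "\<dots> = cls (pconst (a v) * p + q)"
    using p q P.m_closed[OF pconst_closed p(1), of "a v"]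
    by (simp add: cls_smult cls_add P_simps)
  finally show ?case
    using insert p q P.m_closed[OF pconst_closed p(1), of "a v"]
      P.a_closed[OF P.m_closed[OF pconst_closed p(1), of "a v"] q(1)] coord_cls[OF L q(1)]
    by (simp add: coord_cls[OF L] P_simps reduced_coeff_add reduced_coeff_pconst_mult)
qed

lemma finite_indep_sets: "finite (indep_sets G)"
  by (rule finite_subset[of _ "Pow (verts G)"]) (auto simp: indep_sets_def)

lemma X_indep_subset: "X ` indep_sets G \<subseteq> carrier H"
  by (auto simp: indep_sets_def intro: X_closed)

lemma X_lin_indpt: "H.lin_indpt (X ` indep_sets G)"
proof (rule H.finite_lin_indpt2)
  show "finite (X ` indep_sets G)" by (simp add: finite_indep_sets)
  show "X ` indep_sets G \<subseteq> carrier H" by (rule X_indep_subset)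
  fix a :: "('v, 'k) mvpoly set \<Rightarrow> 'k"
  assume 0: "H.lincomb a (X ` indep_sets G) = \<zero>\<^bsub>H\<^esub>"
  have "a (X L) = 0" if L: "L \<in> indep_sets G" for L
  proof -
    \<comment> \<open>The linear combination is indexed by the elements \<open>X I\<close>, not by
      the sets \<open>I\<close>; duality allows the case distinction to be made on the
      elements.\<close>
    have "coord L (X I) = (if X I = X L then 1 else 0)" if "I \<in> indep_sets G" for I
      using coord_X[OF L] L that by (metis zero_neq_one)
    then have "a v * coord L v = (if v = X L then a v else 0)" if "v \<in> X ` indep_sets G" for v
      using that by (elim imageE) simp
    then have "(\<Sum>v\<in>X ` indep_sets G. a v * coord L v) =
        (\<Sum>v\<in>X ` indep_sets G. if v = X L then a v else 0)"
      by (rule sum.cong[OF refl])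
    also have "\<dots> = a (X L)"
      using L finite_indep_sets by simp
    finally have "a (X L) = coord L \<zero>\<^bsub>H\<^esub>"
      using coord_lincomb[OF L _ X_indep_subset, of a] finite_indep_sets 0 by simp
    also have "\<dots> = 0"
      using coord_cls[OF L P.zero_closed] by (simp add: cls_0 P_simps)
    finally show ?thesis .
  qed
  then show "\<forall>v\<in>X ` indep_sets G. a v = \<zero>\<^bsub>class_ring\<^esub>"
    by (auto simp: class_ring_simps)
qed

lemma inj_X: "inj_on X (indep_sets G)"
  by (rule inj_onI) (metis coord_X zero_neq_one)

lemma gen_set_if:
  assumes "S \<subseteq> carrier H" "\<And>I. I \<in> indep_sets G \<Longrightarrow> X I \<in> H.span S"
  shows "H.gen_set S"
  using assms by (intro submodule_eq_carrier H.span_is_submodule)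

lemma X_basis: "H.basis (X ` indep_sets G)"
  unfolding H.basis_def
  using X_lin_indpt X_indep_subset gen_set_if[OF X_indep_subset] H.in_own_span[OF X_indep_subset]
  by blast

lemma H_fin_dim: "H.fin_dim"
  unfolding H.fin_dim_def
proof (intro exI conjI)
  show "finite (X ` indep_sets G)" by (simp add: finite_indep_sets)
  show "X ` indep_sets G \<subseteq> carrier H" "H.gen_set (X ` indep_sets G)"
    using X_basis unfolding H.basis_def by simp_all
qed

lemma H_dim: "H.dim = card (indep_sets G)"
  using H.dim_basis[OF _ X_basis] finite_indep_sets by (simp add: card_image[OF inj_X])

section \<open>The second basis\<close>

text \<open>The second family is indexed by one independent set \<open>L\<close>, standing for
  \<open>I + J\<close> with \<open>I = L - R\<close> and \<open>J\<close> the part of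
  \<open>L\<close> in \<open>R\<close>. Removing \<open>L\<close> or \<open>I\<close> from the
  vertices outside \<open>R\<close> leaves the same set.\<close>

definition Y :: "'v set \<Rightarrow> ('v, 'k) mvpoly set" where
  "Y L = X L \<otimes>\<^bsub>H\<^esub> Xm (verts G - R - L)"

lemma Y_closed: "L \<subseteq> verts G \<Longrightarrow> Y L \<in> carrier H"
  unfolding Y_def by (intro HR.m_closed X_closed Xm_closed) auto

text \<open>The factor \<open>1 = x v + (1 - x v)\<close> is inserted and distributed.\<close>

lemma split_at_vertex:
  assumes "A \<subseteq> verts G" "B \<subseteq> verts G" "v \<in> verts G" "v \<notin> A" "v \<notin> B"
  shows "X A \<otimes>\<^bsub>H\<^esub> Xm B =
    X (insert v A) \<otimes>\<^bsub>H\<^esub> Xm B \<oplus>\<^bsub>H\<^esub> X A \<otimes>\<^bsub>H\<^esub> Xm (insert v B)"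
proof -
  let ?y = "\<one>\<^bsub>H\<^esub> \<ominus>\<^bsub>H\<^esub> x v"
  note closed = x_closed[OF assms(3)] X_closed[OF assms(1)] Xm_closed[OF assms(2)]
  have y: "?y \<in> carrier H" "x v \<oplus>\<^bsub>H\<^esub> ?y = \<one>\<^bsub>H\<^esub>"
    using closed(1) H.M.a_lcomm[of "x v" "\<one>\<^bsub>H\<^esub>" "\<ominus>\<^bsub>H\<^esub> x v"]
    by (simp_all add: H.M.minus_eq H.M.r_neg)
  have "X (insert v A) \<otimes>\<^bsub>H\<^esub> Xm B = X A \<otimes>\<^bsub>H\<^esub> (x v \<otimes>\<^bsub>H\<^esub> Xm B)"
    using assms closed by (simp add: X_insert HR.m_ac)
  moreover have "X A \<otimes>\<^bsub>H\<^esub> Xm (insert v B) = X A \<otimes>\<^bsub>H\<^esub> (?y \<otimes>\<^bsub>H\<^esub> Xm B)"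
    using assms by (simp add: Xm_insert)
  ultimately have "X (insert v A) \<otimes>\<^bsub>H\<^esub> Xm B \<oplus>\<^bsub>H\<^esub> X A \<otimes>\<^bsub>H\<^esub> Xm (insert v B) =
      X A \<otimes>\<^bsub>H\<^esub> ((x v \<oplus>\<^bsub>H\<^esub> ?y) \<otimes>\<^bsub>H\<^esub> Xm B)"
    using closed y(1) by (simp add: HR.l_distr HR.r_distr)
  then show ?thesis
    using closed y(2) by simp
qed

text \<open>The set \<open>B\<close> generalizes the case of a bare \<open>X A\<close> for the
  induction, which counts the undecided vertices outside \<open>R\<close>, those in neither
  \<open>A\<close> nor \<open>B\<close>. Splitting at one of them puts it into \<open>A\<close> in
  one summand and into \<open>B\<close> in the other.\<close>

lemma Y_spans:
  assumes "A \<subseteq> verts G" "B \<subseteq> verts G - R - A"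
  shows "X A \<otimes>\<^bsub>H\<^esub> Xm B \<in> H.span (Y ` indep_sets G)"
proof -
  have sub: "Y ` indep_sets G \<subseteq> carrier H"
    by (auto simp: indep_sets_def intro: Y_closed)
  interpret S: submodule class_ring "H.span (Y ` indep_sets G)" H
    by (rule H.span_is_submodule[OF sub])
  show ?thesis
    using assms
  proof (induction "card (verts G - R - A - B)" arbitrary: A B)
    case 0
    then have "B = verts G - R - A" by auto
    then have AB: "X A \<otimes>\<^bsub>H\<^esub> Xm B = Y A" by (simp add: Y_def)
    show ?case
    proof (cases "A \<in> indep_sets G")
      case True
      then show ?thesis using H.in_own_span[OF sub] by (auto simp: AB)
    next
      \<comment> \<open>Splitting adds vertices to \<open>A\<close> regardless of adjacency, so
        \<open>A\<close> may have ceased to be independent; the product is then zero.\<close>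
      case False
      then have "X A \<otimes>\<^bsub>H\<^esub> Xm B = \<zero>\<^bsub>H\<^esub>"
        using 0 X_eq_0 by (auto intro!: HR.l_null Xm_closed)
      then show ?thesis by (simp add: S.zero_closed)
    qed
  next
    case (Suc n)
    then obtain v where v: "v \<in> verts G - R - A - B"
      by (metis card.empty ex_in_conv nat.distinct(1))
    have "card (verts G - R - A - B - {v}) = n"
      using Suc(2) v by simp
    \<comment> \<open>In both summands exactly \<open>v\<close> leaves the set of undecided
      vertices.\<close>
    moreover have "verts G - R - insert v A - B = verts G - R - A - B - {v}"
      "verts G - R - A - insert v B = verts G - R - A - B - {v}" by auto
    ultimately have "X (insert v A) \<otimes>\<^bsub>H\<^esub> Xm B \<in> H.span (Y ` indep_sets G)"
      "X A \<otimes>\<^bsub>H\<^esub> Xm (insert v B) \<in> H.span (Y ` indep_sets G)"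
      using Suc.prems v by (auto intro!: Suc.hyps(1))
    then show ?case
      using split_at_vertex[of A B v] Suc.prems v S.m_closed by (simp add: subset_iff)
  qed
qed

lemma Y_basis: "H.basis (Y ` indep_sets G)"
proof (rule H.dim_gen_is_basis)
  show "finite (Y ` indep_sets G)" by (simp add: finite_indep_sets)
  show sub: "Y ` indep_sets G \<subseteq> carrier H"
    by (auto simp: indep_sets_def intro: Y_closed)
  have "X I \<in> H.span (Y ` indep_sets G)" if "I \<in> indep_sets G" for I
    using Y_spans[of I "{}"] X_closed[of I] that by (auto simp: Xm_empty indep_sets_def)
  with sub show "H.gen_set (Y ` indep_sets G)" by (rule gen_set_if)
  show "card (Y ` indep_sets G) \<le> H.dim"
    by (simp add: H_dim card_image_le finite_indep_sets)
qed

end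

section \<open>Splitting independent sets into parts outside and inside \<open>R\<close>\<close>

lemma indep_sets_induce_subgraph:
  assumes "wf_digraph G" "W \<subseteq> verts G"
  shows "indep_sets (G \<restriction> W) = {U \<in> indep_sets G. U \<subseteq> W}"
proof -
  have "u \<rightarrow>\<^bsub>G \<restriction> W\<^esub> v \<longleftrightarrow> u \<rightarrow>\<^bsub>G\<^esub> v" if "u \<in> W" "v \<in> W" for u v
    using that by (force simp: arcs_ends_def arc_to_ends_def)
  then show ?thesis
    using assms(2) by (auto simp: indep_sets_def) blast+
qed

text \<open>An independent \<open>L\<close> splits as \<open>L - R\<close> and
  \<open>L \<inter> R\<close>, and the second part avoids the neighbours of the first. Conversely,
  an edge within \<open>I \<union> J\<close> would have to join \<open>I\<close> to
  \<open>J\<close>, contrary to \<open>J\<close> avoiding \<open>nbhd G I\<close>.\<close>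

lemma (in graph) indep_sets_split:
  assumes "R \<subseteq> verts G"
  shows "indep_sets G =
    {I \<union> J | I J. I \<in> indep_sets (G \<restriction> (verts G - R)) \<and> J \<in> indep_sets (G \<restriction> (R - nbhd G I))}"
    (is "_ = ?S")
proof -
  have R': "R - nbhd G I \<subseteq> verts G" for I using assms by auto
  note ind = indep_sets_induce_subgraph[OF wf_digraph_axioms Diff_subset]
    indep_sets_induce_subgraph[OF wf_digraph_axioms R']
  show ?thesis
  proof (intro equalityI subsetI)
    fix L assume L: "L \<in> indep_sets G"
    have "L = (L - R) \<union> (L \<inter> R)" by auto
    moreover have "L - R \<in> indep_sets (G \<restriction> (verts G - R))"
      unfolding ind using L by (auto simp: indep_sets_def)
    moreover have "L \<inter> R \<in> indep_sets (G \<restriction> (R - nbhd G (L - R)))"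
      unfolding ind using L by (auto simp: indep_sets_def nbhd_def)
    ultimately show "L \<in> ?S" by blast
  next
    fix L assume "L \<in> ?S"
    then obtain I J where L: "L = I \<union> J" and ind': "I \<in> indep_sets G" "J \<in> indep_sets G"
      and J: "J \<inter> nbhd G I = {}"
      unfolding ind by blast
    have "\<not> u \<rightarrow>\<^bsub>G\<^esub> v" if "u \<in> L" "v \<in> L" for u v
    proof
      assume uv: "u \<rightarrow>\<^bsub>G\<^esub> v"
      \<comment> \<open>\<open>nbhd\<close> follows arcs leaving \<open>I\<close>, so an arc from
        \<open>J\<close> to \<open>I\<close> is excluded through its reverse.\<close>
      then have vu: "v \<rightarrow>\<^bsub>G\<^esub> u"
        by (rule arcs_ends_symmetric[OF sym_arcs])
      have *: False if "a \<in> I" "b \<in> J" "a \<rightarrow>\<^bsub>G\<^esub> b" for a b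
        using that J adj_in_verts[OF that(3)] unfolding nbhd_def by blast
      have "u \<in> I \<and> v \<in> I \<or> u \<in> J \<and> v \<in> J"
        using that uv vu *[of u v] *[of v u] unfolding L by blast
      then show False
        using uv ind' unfolding indep_sets_def by blast
    qed
    moreover have "L \<subseteq> verts G"
      unfolding L using ind' by (simp add: indep_sets_def)
    ultimately show "L \<in> indep_sets G"
      by (simp add: indep_sets_def)
  qed
qed

theorem proposition6p3:
  fixes G :: "('v, 'e) pre_digraph" and R :: "'v set"
  assumes "graph G" and "R \<subseteq> verts G"
  shows
    "vectorspace.fin_dim (class_ring :: 'k::field ring) (graph_algebra G R)
     \<and> vectorspace.dim (class_ring :: 'k ring) (graph_algebra G R) = card (indep_sets G)
     \<and> vectorspace.basis (class_ring :: 'k ring) (graph_algebra G R)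
          {X_prod G R I | I. I \<in> indep_sets G}
     \<and> vectorspace.basis (class_ring :: 'k ring) (graph_algebra G R)
          {X_prod G R (I \<union> J) \<otimes>\<^bsub>graph_algebra G R\<^esub> X_minus_prod G R (verts G - R - I) | I J.
             I \<in> indep_sets (G \<restriction> (verts G - R)) \<and>
             J \<in> indep_sets (G \<restriction> (R - nbhd G I))}"
proof -
  interpret graph G by fact
  interpret Q: graph_quotient G R "TYPE('k)"
    by unfold_locales (rule assms(2))
  \<comment> \<open>Since \<open>J\<close> lies in \<open>R\<close>, this rewrites the index set of
    the second product into the form used by \<open>Y\<close>.\<close>
  have "verts G - R - I = verts G - R - (I \<union> J)" if "J \<in> indep_sets (G \<restriction> (R - nbhd G I))" for I J
    using that by (auto simp: indep_sets_def)
  then have "Q.Y ` indep_sets G =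
      {X_prod G R (I \<union> J) \<otimes>\<^bsub>graph_algebra G R\<^esub> X_minus_prod G R (verts G - R - I) | I J.
        I \<in> indep_sets (G \<restriction> (verts G - R)) \<and> J \<in> indep_sets (G \<restriction> (R - nbhd G I))}"
    unfolding indep_sets_split[OF assms(2)] Q.Y_def by (auto simp: image_iff) metis+
  moreover have "Q.X ` indep_sets G = {X_prod G R I | I. I \<in> indep_sets G}"
    by blast
  ultimately show ?thesis
    using Q.H_fin_dim Q.H_dim Q.X_basis Q.Y_basis by simp
qed

end
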